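(* Consider any adaptive one-query quantile process $\mathrm{Quantile}(\delta)$, or any adaptive one-query threshold process $\mathrm{Threshold}(f)$, allocating balls into $n$ bins. Then \[ \Pr\Big[\max_{t \in [1, n \log^2 n]} \mathrm{Gap}(t) \geq \tfrac{1}{8} \cdot \tfrac{\log n}{\log \log n}\Big] \geq 1-o(n^{-2}). \]
   Context: Balls are allocated sequentially into $n$ bins, starting from all loads $0$. Let $x_i^{(t)}$ be the load of bin $i$ after $t$ balls, and $\mathrm{Gap}(t) := \max_{i} x_i^{(t)} - t/n$. Let $y^{(t)}$ be the load vector sorted in non-increasing order, and let $\mathrm{Rank}^{(t)}$ be a permutation of $[n]$ with $y^{(t)}_{\mathrm{Rank}^{(t)}(i)} = x_i^{(t)}$ (rank $1$ = most loaded bin; ties broken arbitrarily). In the one-query quantile process $\mathrm{Quantile}(\delta)$, at each step $t$ a value $\delta(t) \in \{1/n, 2/n, \ldots, 1\}$ is used; two bins are sampled independently and uniformly at random (with replacement), and each is asked whether its rank (with respect to the current load vector) is at most $\delta(t) \cdot n$; if exactly one of the two bins answers "no" (rank $> \delta(t) n$, i.e. it is among the lighter bins), the ball is placed into it, otherwise the ball is placed into one of the two bins chosen uniformly at random. In the one-query threshold process $\mathrm{Threshold}(f)$, at step $t$ a value $f(t)$ is used, each of the two sampled bins is asked whether its load is at least $f(t)$, and the ball is placed in the bin whose load is below $f(t)$ if exactly one such bin exists, otherwise in a uniformly random one of the two. The process is adaptive if $\delta(t)$ (resp. $f(t)$) may depend on the entire history of the process, i.e. on the load vector before step $t$. As throughout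 the paper, $n$ is assumed sufficiently large. *)

theory Defs
  imports "HOL-Probability.Probability" "HOL-Library.Landau_Symbols"
begin

text \<open>The bins are \<open>1, \<dots>, n\<close>. A history lists, in chronological order, one triple
  \<open>(i, j, c)\<close> per ball: the two sampled bins \<open>i\<close>, \<open>j\<close> and the bin \<open>c\<close> that received the ball.
  An adaptive parameter is an arbitrary function of the history before the current step,
  so it may in particular depend on the step number and on all load vectors so far.\<close>

type_synonym history = "(nat \<times> nat \<times> nat) list"

definition load :: "history \<Rightarrow> nat \<Rightarrow> nat" where
  "load h b = count_list (map (\<lambda>(i, j, c). c) h) b"

definition Gap :: "nat \<Rightarrow> history \<Rightarrow> nat \<Rightarrow> real" where
  "Gap n h t = real (MAX i\<in>{1..n}. load (take t h) i) - real t / real n"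

text \<open>\<open>yes b\<close> is the answer of bin \<open>b\<close> to the query, \<open>True\<close> meaning that it is among the
  heavier bins. If \<open>i = j\<close>, the last case places the ball into that bin.\<close>

definition place :: "(nat \<Rightarrow> bool) \<Rightarrow> nat \<Rightarrow> nat \<Rightarrow> nat pmf" where
  "place yes i j =
     (if yes i \<and> \<not> yes j then return_pmf j
      else if \<not> yes i \<and> yes j then return_pmf i
      else pmf_of_set {i, j})"

primrec one_query_process :: "nat \<Rightarrow> (history \<Rightarrow> nat \<Rightarrow> bool) \<Rightarrow> nat \<Rightarrow> history pmf" where
  "one_query_process n yes 0 = return_pmf []"
| "one_query_process n yes (Suc t) =
     do {
       h \<leftarrow> one_query_process n yes t;
       (i, j) \<leftarrow> pmf_of_set ({1..n} \<times> {1..n});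
       c \<leftarrow> place (yes h) i j;
       return_pmf (h @ [(i, j, c)])
     }"

text \<open>The \<open>k\<close>-th largest load, \<open>1 \<le> k \<le> n\<close>.\<close>

definition sorted_load :: "nat \<Rightarrow> history \<Rightarrow> nat \<Rightarrow> nat" where
  "sorted_load n h k = rev (sort (map (load h) [1..<Suc n])) ! (k - 1)"

definition is_rank :: "nat \<Rightarrow> history \<Rightarrow> (nat \<Rightarrow> nat) \<Rightarrow> bool" where
  "is_rank n h r \<longleftrightarrow>
     bij_betw r {1..n} {1..n} \<and> (\<forall>i\<in>{1..n}. sorted_load n h (r i) = load h i)"

definition quantile_process ::
    "nat \<Rightarrow> (history \<Rightarrow> real) \<Rightarrow> (history \<Rightarrow> nat \<Rightarrow> nat) \<Rightarrow> nat \<Rightarrow> history pmf" where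
  "quantile_process n \<delta> Rank =
     one_query_process n (\<lambda>h b. real (Rank h b) \<le> \<delta> h * real n)"

definition threshold_process :: "nat \<Rightarrow> (history \<Rightarrow> real) \<Rightarrow> nat \<Rightarrow> history pmf" where
  "threshold_process n f = one_query_process n (\<lambda>h b. real (load h b) \<ge> f h)"

definition horizon :: "nat \<Rightarrow> nat" where
  "horizon n = nat \<lfloor>real n * (ln (real n))\<^sup>2\<rfloor>"

definition large_gap :: "nat \<Rightarrow> history set" where
  "large_gap n =
     {h. (MAX t\<in>{1..horizon n}. Gap n h t) \<ge> 1 / 8 * (ln (real n) / ln (ln (real n)))}"

end

theory Submission
  imports Defs "HOL-Real_Asymp.Real_Asymp"
begin

text \<open>Let \<open>L = ln n\<close>, let \<open>g = L / (8 ln L)\<close> be the target gap, and call a step heavy if at least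
  \<open>n / L\<^sup>2\<close> bins answer yes. With \<open>k\<close> positive answers a bin receives the ball with
  probability \<open>(k + n) / n\<^sup>2\<close> or \<open>k / n\<^sup>2\<close>; nothing else about the answers matters.
  Cut the time into windows of \<open>n\<close> steps and suppose that the gap never reaches \<open>g\<close>.

  If some window contains \<open>n / L\<^sup>2\<close> heavy steps, then at its start at least \<open>n / (g + 1)\<close> bins
  are not below the average, and each heavy step hits any given bin with probability at least
  \<open>1 / (n L\<^sup>2)\<close>. Some bin then receives \<open>g + 1\<close> balls, except with probability
  \<open>exp (- n powr (3 / 8 - o(1)))\<close>. The comparison with independent hits is a supermartingale: the
  product over the bins of the probabilities that a binomial variable, whose number of trials is
  the number of heavy steps still to come, stays below the number of balls still missing.

  Otherwise there are only \<open>O(n)\<close> heavy steps. The other steps are close to One-Choice, and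
  a truncated quadratic potential grows by at least a constant in expectation per step as
  long as the gap is below \<open>g\<close>. After \<open>n L\<^sup>2\<close> steps it exceeds \<open>4 n g\<^sup>2\<close>, the largest
  value compatible with a gap below \<open>g\<close>.\<close>

section \<open>The law of a single step\<close>

definition heavy :: "nat \<Rightarrow> (nat \<Rightarrow> bool) \<Rightarrow> nat" where
  "heavy n Y = card {i \<in> {1..n}. Y i}"

text \<open>Count ordered pairs of samples, with \<open>k\<close> yes bins. A no bin wins the
  \<open>2 * k\<close> pairs with a yes bin and, on average, \<open>n - k\<close> of the pairs with
  a no bin. A yes bin wins only pairs of two yes bins, \<open>k\<close> on average.\<close>

definition recv :: "nat \<Rightarrow> (nat \<Rightarrow> bool) \<Rightarrow> nat \<Rightarrow> real" where
  "recv n Y i = (real n + real (heavy n Y) - (if Y i then real n else 0)) / (real n)\<^sup>2"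

definition ball_step :: "nat \<Rightarrow> (nat \<Rightarrow> bool) \<Rightarrow> (nat \<times> nat \<times> nat) pmf" where
  "ball_step n Y =
     do {
       (i, j) \<leftarrow> pmf_of_set ({1..n} \<times> {1..n});
       c \<leftarrow> place Y i j;
       return_pmf (i, j, c)
     }"

lemma one_query_process_Suc:
  "one_query_process n yes (Suc t) =
     one_query_process n yes t \<bind> (\<lambda>h. map_pmf (\<lambda>x. h @ [x]) (ball_step n (yes h)))"
  by (simp add: ball_step_def map_pmf_def bind_assoc_pmf bind_return_pmf split_def)

lemma heavy_le: "heavy n Y \<le> n"
  unfolding heavy_def by (rule order_trans[OF card_mono[of "{1..n}"]]) auto

lemma heavy_sum: "real (heavy n Y) = (\<Sum>i\<in>{1..n}. of_bool (Y i))"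
  by (simp add: heavy_def of_bool_def flip: sum.inter_filter)

lemma recv_ge: "recv n Y i \<ge> real (heavy n Y) / (real n)\<^sup>2"
  by (auto simp: recv_def divide_right_mono)

lemma recv_nonneg: "recv n Y i \<ge> 0"
  by (auto simp: recv_def divide_right_mono)

text \<open>Compares the step with One-Choice: the first term is the uniform average, and the two
  corrections are governed by the fraction of yes answers.\<close>

lemma sum_recv_mult:
  assumes "n > 0"
  shows "(\<Sum>i\<in>{1..n}. recv n Y i * f i) =
    (\<Sum>i\<in>{1..n}. f i) / n + real (heavy n Y) / n * ((\<Sum>i\<in>{1..n}. f i) / n)
      - (\<Sum>i\<in>{1..n}. of_bool (Y i) * f i) / n"
proof -
  have "recv n Y i * f i = f i / n + real (heavy n Y) / n * (f i / n) - of_bool (Y i) * f i / n" for i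
    using assms by (auto simp: recv_def field_simps power2_eq_square)
  thus ?thesis
    by (simp only: sum_subtractf sum.distrib sum_distrib_left sum_divide_distrib)
qed

lemma sum_recv: "n > 0 \<Longrightarrow> (\<Sum>i\<in>{1..n}. recv n Y i) = 1"
  using sum_recv_mult[of n Y "\<lambda>_. 1"]
  unfolding mult_1_right heavy_sum[symmetric] by simp

text \<open>If the answers agree, the correction vanishes and the plain average remains; if they
  differ, it moves all the mass to the bin answering no.\<close>

lemma expectation_place:
  fixes f :: "nat \<Rightarrow> real"
  shows "measure_pmf.expectation (place Y i j) f =
    (f i + f j) / 2 + (of_bool (Y i) - of_bool (Y j)) * (f j - f i) / 2"
proof -
  have "measure_pmf.expectation (pmf_of_set {i, j}) f = (f i + f j) / 2"
    by (cases "i = j") (simp_all add: integral_pmf_of_set)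
  thus ?thesis
    by (auto simp: place_def field_simps)
qed

lemma expectation_ball_step:
  fixes f :: "nat \<Rightarrow> real"
  assumes "n > 0"
  shows "measure_pmf.expectation (ball_step n Y) (\<lambda>(i, j, c). f c) = (\<Sum>i\<in>{1..n}. recv n Y i * f i)"
proof -
  let ?I = "{1..n}"
  let ?y = "\<lambda>i. of_bool (Y i) :: real"
  have fin: "finite (set_pmf (place Y i j))" for i j
    by (auto simp: place_def)
  have "measure_pmf.expectation (ball_step n Y) (\<lambda>(i, j, c). f c) =
     (\<Sum>(i,j)\<in>?I \<times> ?I. measure_pmf.expectation (place Y i j) f / n\<^sup>2)"
    unfolding ball_step_def
    apply (subst pmf_expectation_bind_pmf_of_set)
    using assms apply (auto simp: fin)[3]
    apply (rule sum.cong)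
    using assms
    by (auto simp: map_pmf_def[symmetric] power2_eq_square field_simps)
  also have "\<dots> = (\<Sum>i\<in>?I. \<Sum>j\<in>?I. (f i / 2 + f j / 2
      + (?y i * f j - ?y i * f i - ?y j * f j + ?y j * f i) / 2) / n\<^sup>2)"
    unfolding sum.cartesian_product[symmetric]
    by (intro sum.cong refl) (simp add: expectation_place field_simps)
  also have "\<dots> = (n * (\<Sum>i\<in>?I. f i) + (\<Sum>i\<in>?I. ?y i) * (\<Sum>i\<in>?I. f i)
      - n * (\<Sum>i\<in>?I. ?y i * f i)) / n\<^sup>2"
    by (simp only: sum_divide_distrib[symmetric] sum.distrib sum_subtractf sum_constant
        sum_distrib_left[symmetric] sum_distrib_right[symmetric])
      (simp add: algebra_simps diff_divide_distrib add_divide_distrib del: One_nat_def sum_of_bool_eq sum_mult_of_bool_eq sum_of_bool_mult_eq)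
  also have "\<dots> = (\<Sum>i\<in>?I. recv n Y i * f i)"
    using assms unfolding sum_recv_mult[OF assms] heavy_sum[symmetric]
    by (simp add: field_simps power2_eq_square del: One_nat_def sum_of_bool_eq sum_mult_of_bool_eq sum_of_bool_mult_eq)
  finally show ?thesis .
qed

lemma set_pmf_ball_step: "n > 0 \<Longrightarrow> (i, j, c) \<in> set_pmf (ball_step n Y) \<Longrightarrow> c \<in> {1..n}"
  by (auto simp: ball_step_def place_def split: if_splits)

lemma finite_set_pmf_ball_step: "n > 0 \<Longrightarrow> finite (set_pmf (ball_step n Y))"
  by (auto simp: ball_step_def place_def)

lemma nn_integral_ball_step_le:
  assumes "n > 0" and Z: "\<And>i j c. c \<in> {1..n} \<Longrightarrow> Z (i, j, c) \<le> f c"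
    and f: "\<And>c. c \<in> {1..n} \<Longrightarrow> 0 \<le> f c"
  shows "(\<integral>\<^sup>+x. ennreal (Z x) \<partial>ball_step n Y) \<le> ennreal (\<Sum>c\<in>{1..n}. recv n Y c * f c)"
proof -
  have "(\<integral>\<^sup>+x. ennreal (Z x) \<partial>ball_step n Y) \<le> (\<integral>\<^sup>+x. ennreal ((\<lambda>(i, j, c). f c) x) \<partial>ball_step n Y)"
    using set_pmf_ball_step[OF assms(1)] Z
    by (intro nn_integral_mono_AE AE_pmfI) (fastforce intro!: ennreal_leI)
  also have "\<dots> = ennreal (measure_pmf.expectation (ball_step n Y) (\<lambda>(i, j, c). f c))"
    using f set_pmf_ball_step[OF assms(1)]
    by (intro nn_integral_eq_integral integrable_measure_pmf_finite finite_set_pmf_ball_step assms AE_pmfI) auto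
  also have "\<dots> = ennreal (\<Sum>c\<in>{1..n}. recv n Y c * f c)"
    using expectation_ball_step[OF assms(1), of Y f] by simp
  finally show ?thesis .
qed

section \<open>Prefixes of the process and a supermartingale bound\<close>

lemma set_pmf_one_query_process:
  assumes "n > 0" "h \<in> set_pmf (one_query_process n yes t)"
  shows "length h = t" "\<forall>(i, j, c) \<in> set h. c \<in> {1..n}"
proof -
  have "length h = t \<and> (\<forall>(i, j, c) \<in> set h. c \<in> {1..n})"
    using assms(2)
  proof (induction t arbitrary: h)
    case (Suc t)
    from Suc.prems obtain h' x where h': "h' \<in> set_pmf (one_query_process n yes t)"
      and x: "x \<in> set_pmf (ball_step n (yes h'))" and h: "h = h' @ [x]"
      unfolding one_query_process_Suc by auto
    from x set_pmf_ball_step[OF assms(1)] Suc.IH[OF h'] show ?case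
      unfolding h by (cases x) auto
  qed simp
  thus "length h = t" "\<forall>(i, j, c) \<in> set h. c \<in> {1..n}" by auto
qed

text \<open>A later step only appends to the history, so an event decided by the first
  \<open>s\<close> balls may be evaluated in the shorter process.\<close>

lemma map_take_one_query_process:
  assumes "n > 0"
  shows "map_pmf (take s) (one_query_process n yes (s + r)) = one_query_process n yes s"
proof (induction r)
  case 0
  have "map_pmf (take s) (one_query_process n yes s) = map_pmf id (one_query_process n yes s)"
    using set_pmf_one_query_process(1)[OF assms] by (intro map_pmf_cong) auto
  thus ?case by simp
next
  case (Suc r)
  have "map_pmf (take s) (one_query_process n yes (s + Suc r)) =
     one_query_process n yes (s + r) \<bind> (\<lambda>h. map_pmf (\<lambda>x. take s (h @ [x])) (ball_step n (yes h)))"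
    by (simp only: add_Suc_right one_query_process_Suc map_bind_pmf map_pmf_comp)
  also have "\<dots> = one_query_process n yes (s + r) \<bind> (\<lambda>h. map_pmf (\<lambda>x. take s h) (ball_step n (yes h)))"
    using set_pmf_one_query_process(1)[OF assms] by (intro bind_pmf_cong) auto
  also have "\<dots> = map_pmf (take s) (one_query_process n yes (s + r))"
    by (simp add: map_pmf_const) (simp add: map_pmf_def)
  finally show ?case using Suc.IH by simp
qed

lemma prob_take_one_query_process:
  assumes "n > 0" "s \<le> t"
  shows "measure_pmf.prob (one_query_process n yes t) {h. take s h \<in> A} =
    measure_pmf.prob (one_query_process n yes s) A"
  using map_take_one_query_process[OF assms(1), of s yes "t - s"] assms(2)
  by (metis le_add_diff_inverse measure_map_pmf vimage_def)

text \<open>The expectation of \<open>Z\<close> does not increase from time \<open>s\<close> to time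
  \<open>t\<close>, and Markov's inequality at level 1 gives the bound. The majorant
  \<open>f\<close> depends only on the receiving bin, whose law is \<open>recv\<close>.\<close>

lemma prob_supermartingale_le:
  fixes Z :: "history \<Rightarrow> real"
  assumes "n > 0" "s \<le> t" "b \<ge> 0"
    and init: "\<And>h. h \<in> set_pmf (one_query_process n yes s) \<Longrightarrow> Z h \<le> b"
    and step: "\<And>h. h \<in> set_pmf (one_query_process n yes (length h)) \<Longrightarrow> s \<le> length h \<Longrightarrow> length h < t \<Longrightarrow>
      \<exists>f. (\<forall>c\<in>{1..n}. f c \<ge> 0 \<and> (\<forall>i j. Z (h @ [(i, j, c)]) \<le> f c)) \<and>
          (\<Sum>c\<in>{1..n}. recv n (yes h) c * f c) \<le> Z h"
    and final: "\<And>h. h \<in> A \<Longrightarrow> h \<in> set_pmf (one_query_process n yes t) \<Longrightarrow> Z h \<ge> 1"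
  shows "measure_pmf.prob (one_query_process n yes t) A \<le> b"
proof -
  let ?E = "\<lambda>t. \<integral>\<^sup>+h. ennreal (Z h) \<partial>one_query_process n yes t"
  have "?E (s + r) \<le> ennreal b" if "s + r \<le> t" for r
    using that
  proof (induction r)
    case 0
    have "?E s \<le> (\<integral>\<^sup>+h. ennreal b \<partial>one_query_process n yes s)"
      by (intro nn_integral_mono_AE AE_pmfI ennreal_leI init)
    thus ?case by (simp add: measure_pmf.emeasure_space_1)
  next
    case (Suc r)
    have "?E (s + Suc r) = (\<integral>\<^sup>+h. \<integral>\<^sup>+x. ennreal (Z (h @ [x])) \<partial>ball_step n (yes h) \<partial>one_query_process n yes (s + r))"
      unfolding add_Suc_right one_query_process_Suc by (simp add: nn_integral_bind_pmf)
    also have "\<dots> \<le> ?E (s + r)"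
    proof (intro nn_integral_mono_AE AE_pmfI)
      fix h assume h: "h \<in> set_pmf (one_query_process n yes (s + r))"
      with step[of h] set_pmf_one_query_process(1)[OF assms(1) h] Suc.prems
      obtain f where f: "\<forall>c\<in>{1..n}. f c \<ge> 0 \<and> (\<forall>i j. Z (h @ [(i, j, c)]) \<le> f c)"
        "(\<Sum>c\<in>{1..n}. recv n (yes h) c * f c) \<le> Z h" by auto
      from nn_integral_ball_step_le[OF assms(1), of "\<lambda>x. Z (h @ [x])" f "yes h"] f
      show "(\<integral>\<^sup>+x. ennreal (Z (h @ [x])) \<partial>ball_step n (yes h)) \<le> ennreal (Z h)"
        by (meson ennreal_leI order_trans)
    qed
    also have "\<dots> \<le> ennreal b" using Suc by simp
    finally show ?case .
  qed
  from this[of "t - s"] have E: "?E t \<le> ennreal b" using assms(2) by simp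
  have "emeasure (one_query_process n yes t) A = (\<integral>\<^sup>+h. indicator A h \<partial>one_query_process n yes t)"
    by simp
  also have "\<dots> \<le> ?E t"
    using final by (intro nn_integral_mono_AE AE_pmfI) (auto simp: indicator_def)
  finally show ?thesis
    using E assms(3) by (metis ennreal_le_iff measure_pmf.emeasure_eq_measure order_trans)
qed

section \<open>Windows with many heavy steps\<close>

text \<open>This is the probability that a binomial variable with \<open>r\<close> trials of success
  probability \<open>q\<close> is less than \<open>j\<close>, by conditioning on one trial.
  Truncated subtraction keeps the value 0 at \<open>j = 0\<close>.\<close>

primrec binomial_less :: "real \<Rightarrow> nat \<Rightarrow> nat \<Rightarrow> real" where
  "binomial_less q 0 j = of_bool (j > 0)"
| "binomial_less q (Suc r) j = (1 - q) * binomial_less q r j + q * binomial_less q r (j - 1)"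

lemma binomial_less_0_right [simp]: "binomial_less q r 0 = 0"
  by (induction r) auto

lemma binomial_less_nonneg: "0 \<le> q \<Longrightarrow> q \<le> 1 \<Longrightarrow> 0 \<le> binomial_less q r j"
  by (induction r arbitrary: j) auto

lemma binomial_less_mono:
  "0 \<le> q \<Longrightarrow> q \<le> 1 \<Longrightarrow> i \<le> j \<Longrightarrow> binomial_less q r i \<le> binomial_less q r j"
proof (induction r arbitrary: i j)
  case (Suc r)
  hence "binomial_less q r i \<le> binomial_less q r j"
    "binomial_less q r (i - 1) \<le> binomial_less q r (j - 1)"
    by (simp_all add: diff_le_mono)
  thus ?case using Suc.prems by (auto intro!: add_mono mult_left_mono)
qed auto

text \<open>The complementary event contains the value exactly \<open>j\<close>. Its probability is
  bounded below with exponent \<open>r\<close> instead of \<open>r - j\<close> on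
  \<open>1 - q\<close>, which makes Pascal's rule close the induction.\<close>

lemma binomial_less_le:
  assumes "0 \<le> q" "q \<le> 1"
  shows "binomial_less q r j \<le> 1 - real (r choose j) * q ^ j * (1 - q) ^ r"
proof (induction r arbitrary: j)
  case 0
  show ?case by (cases j) auto
next
  case (Suc r)
  show ?case
  proof (cases j)
    case 0
    thus ?thesis using assms by (simp add: power_le_one mult_le_one)
  next
    case (Suc i)
    have "binomial_less q (Suc r) j \<le>
       (1 - q) * (1 - real (r choose Suc i) * q ^ Suc i * (1 - q) ^ r) +
       q * (1 - real (r choose i) * q ^ i * (1 - q) ^ r)"
      unfolding Suc using assms Suc.IH[of "Suc i"] Suc.IH[of i]
      by (auto intro!: add_mono mult_left_mono)
    also have "\<dots> = 1 - (1 - q) * real (r choose Suc i) * q ^ Suc i * (1 - q) ^ r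
       - real (r choose i) * q ^ Suc i * (1 - q) ^ r"
      by (simp add: algebra_simps)
    also have "\<dots> \<le> 1 - (1 - q) * real (r choose Suc i) * q ^ Suc i * (1 - q) ^ r
       - (1 - q) * (real (r choose i) * q ^ Suc i * (1 - q) ^ r)"
      using assms by (intro diff_left_mono mult_left_le_one_le) auto
    also have "\<dots> = 1 - real (Suc r choose j) * q ^ j * (1 - q) ^ Suc r"
      unfolding Suc by (simp add: algebra_simps)
    finally show ?thesis .
  qed
qed

text \<open>The first-order expansion of the product is a lower bound: adding a factor leaves only
  the nonnegative cross term \<open>x a * ?S\<close>.\<close>

lemma prod_diff_ge:
  fixes A x :: "'a \<Rightarrow> real"
  assumes "finite G" "\<And>i. i \<in> G \<Longrightarrow> 0 \<le> x i" "\<And>i. i \<in> G \<Longrightarrow> x i \<le> A i"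
  shows "prod A G - (\<Sum>c\<in>G. x c * prod A (G - {c})) \<le> (\<Prod>i\<in>G. A i - x i)"
  using assms
proof (induction G rule: finite_induct)
  case (insert a G)
  let ?S = "\<Sum>c\<in>G. x c * prod A (G - {c})"
  have A: "0 \<le> A i" if "i \<in> insert a G" for i
    using insert.prems[OF that] by (rule order_trans)
  have "(\<Sum>c\<in>G. x c * prod A (insert a G - {c})) = (\<Sum>c\<in>G. A a * (x c * prod A (G - {c})))"
  proof (rule sum.cong)
    fix c assume "c \<in> G"
    hence "insert a G - {c} = insert a (G - {c})" using insert.hyps by auto
    thus "x c * prod A (insert a G - {c}) = A a * (x c * prod A (G - {c}))"
      using insert.hyps by simp
  qed simp
  moreover have "insert a G - {a} = G" using insert.hyps by auto
  ultimately have "prod A (insert a G) - (\<Sum>c\<in>insert a G. x c * prod A (insert a G - {c})) =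
      A a * prod A G - (x a * prod A G + A a * ?S)"
    using insert.hyps by (simp add: sum_distrib_left)
  also have "\<dots> \<le> A a * prod A G - (x a * prod A G + A a * ?S) + x a * ?S"
    using insert.prems A by (auto intro!: mult_nonneg_nonneg sum_nonneg prod_nonneg)
  also have "\<dots> = (A a - x a) * (prod A G - ?S)"
    by (simp add: algebra_simps)
  also have "\<dots> \<le> (A a - x a) * (\<Prod>i\<in>G. A i - x i)"
    using insert by (intro mult_left_mono) auto
  also have "\<dots> = (\<Prod>i\<in>insert a G. A i - x i)"
    using insert.hyps by simp
  finally show ?case .
qed auto

text \<open>Exactly one coordinate is hit per step, whereas the right-hand side is the
  corresponding expectation for independent hits of probability \<open>q\<close>.\<close>

lemma sum_prod_single_hit_le:
  fixes A B p :: "'a \<Rightarrow> real"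
  assumes "finite U" "G \<subseteq> U" "sum p U = 1" "0 \<le> q" "q \<le> 1" "\<And>i. i \<in> G \<Longrightarrow> q \<le> p i"
    and "\<And>i. i \<in> G \<Longrightarrow> 0 \<le> B i" "\<And>i. i \<in> G \<Longrightarrow> B i \<le> A i"
  shows "(\<Sum>c\<in>U. p c * (\<Prod>i\<in>G. if i = c then B i else A i)) \<le> (\<Prod>i\<in>G. (1 - q) * A i + q * B i)"
proof -
  have G: "finite G" using assms finite_subset by blast
  have A: "0 \<le> A i" if "i \<in> G" for i using assms(7,8)[OF that] by simp
  \<comment> \<open>A hit in \<open>c\<close> changes a single factor, so summing over
    \<open>c\<close> yields the first-order expansion of the product of independent factors.\<close>
  have prod: "(\<Prod>i\<in>G. if i = c then B i else A i) =
      prod A G - (if c \<in> G then (A c - B c) * prod A (G - {c}) else 0)" for c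
  proof (cases "c \<in> G")
    case True
    have "(\<Prod>i\<in>G. if i = c then B i else A i) = B c * (\<Prod>i\<in>G-{c}. if i = c then B i else A i)"
      using True G by (subst prod.remove[of G c]) auto
    also have "(\<Prod>i\<in>G-{c}. if i = c then B i else A i) = prod A (G - {c})"
      by (intro prod.cong) auto
    also have "prod A G = A c * prod A (G - {c})" using True G by (rule prod.remove[rotated])
    ultimately show ?thesis using True by (simp add: algebra_simps)
  qed (auto intro!: prod.cong)
  have "(\<Sum>c\<in>U. p c * (\<Prod>i\<in>G. if i = c then B i else A i)) =
     (\<Sum>c\<in>U. p c * prod A G - (if c \<in> G then p c * ((A c - B c) * prod A (G - {c})) else 0))"
    unfolding prod by (intro sum.cong) (auto simp: algebra_simps)
  also have "\<dots> = prod A G - (\<Sum>c\<in>G. p c * ((A c - B c) * prod A (G - {c})))"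
    using assms(1,2,3) by (simp add: sum_subtractf sum_distrib_right[symmetric] sum.If_cases Int_absorb1)
  also have "\<dots> \<le> prod A G - (\<Sum>c\<in>G. q * ((A c - B c) * prod A (G - {c})))"
    using assms A by (intro diff_left_mono sum_mono mult_right_mono mult_nonneg_nonneg prod_nonneg) auto
  also have "\<dots> = prod A G - (\<Sum>c\<in>G. (q * (A c - B c)) * prod A (G - {c}))"
    by (simp add: mult.assoc)
  also have "\<dots> \<le> (\<Prod>i\<in>G. A i - q * (A i - B i))"
  proof (rule prod_diff_ge[OF G])
    fix i assume i: "i \<in> G"
    show "0 \<le> q * (A i - B i)" using assms(4) assms(8)[OF i] by simp
    have "q * (A i - B i) \<le> 1 * (A i - B i)"
      using assms(5) assms(8)[OF i] by (intro mult_right_mono) auto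
    thus "q * (A i - B i) \<le> A i" using assms(7)[OF i] by simp
  qed
  also have "\<dots> = (\<Prod>i\<in>G. (1 - q) * A i + q * B i)"
    by (simp add: algebra_simps)
  finally show ?thesis .
qed

section \<open>Loads, counts of marked steps, and the window estimate\<close>

lemma load_Nil [simp]: "load [] b = 0"
  by (simp add: load_def)

lemma load_append [simp]: "load (h @ h') b = load h b + load h' b"
  by (simp add: load_def)

lemma load_single [simp]: "load [(i, j, c)] b = (if b = c then 1 else 0)"
  by (simp add: load_def)

lemma load_take_le: "load (take s h) b \<le> load h b"
proof -
  have "load h b = load (take s h @ drop s h) b" by simp
  thus ?thesis unfolding load_append by linarith
qed

lemma sum_load:
  "\<forall>(i, j, c) \<in> set h. c \<in> {1..n} \<Longrightarrow> (\<Sum>b\<in>{1..n}. load h b) = length h"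
proof (induction h)
  case (Cons x h)
  have "load (x # h) b = load [x] b + load h b" for b
    using load_append[of "[x]" h b] by simp
  with Cons show ?case by (cases x) (auto simp: sum.distrib)
qed simp

text \<open>\<open>P\<close> is tested on the history before each step, so whether the next step
  counts is known before its ball is thrown.\<close>

definition visits :: "(history \<Rightarrow> bool) \<Rightarrow> nat \<Rightarrow> history \<Rightarrow> nat" where
  "visits P s h = card {k \<in> {s..<length h}. P (take k h)}"

lemma visits_length [simp]: "length h \<le> s \<Longrightarrow> visits P s h = 0"
  by (simp add: visits_def)

lemma visits_snoc:
  assumes "s \<le> length h"
  shows "visits P s (h @ [x]) = visits P s h + of_bool (P h)"
proof -
  have "{k \<in> {s..<length (h @ [x])}. P (take k (h @ [x]))} =
    {k \<in> {s..<length h}. P (take k h)} \<union> (if P h then {length h} else {})"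
    using assms by (auto simp: less_Suc_eq)
  thus ?thesis unfolding visits_def by auto
qed

text \<open>Deviations from the average \<open>m\<close> sum to zero. Loads are integers, so a bin
  below \<open>m\<close> contributes at most \<open>-1\<close>, and only the counted bins, each
  contributing at most \<open>g\<close>, can compensate.\<close>

lemma card_bins_above_average:
  fixes g :: real
  assumes "\<forall>(i, j, c) \<in> set h. c \<in> {1..n}" "length h = m * n"
    and "g \<ge> 0" "\<forall>i\<in>{1..n}. real (load h i) < m + g"
  shows "real n / (g + 1) \<le> card {i \<in> {1..n}. m \<le> load h i}"
proof -
  let ?G = "{i \<in> {1..n}. m \<le> load h i}"
  have "(0::real) = real (\<Sum>b\<in>{1..n}. load h b) - real (m * n)"
    using sum_load[OF assms(1)] assms(2) by simp
  also have "\<dots> = (\<Sum>b\<in>{1..n}. real (load h b) - real m)"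
    by (simp add: sum_subtractf)
  also have "\<dots> \<le> (\<Sum>b\<in>{1..n}. (if b \<in> ?G then g + 1 else 0) - 1)"
  proof (rule sum_mono)
    fix b assume b: "b \<in> {1..n}"
    show "real (load h b) - real m \<le> (if b \<in> ?G then g + 1 else 0) - 1"
      using bspec[OF assms(4) b] b by auto
  qed
  also have "\<dots> = card ?G * (g + 1) - n"
    by (subst sum_subtractf, subst sum.inter_restrict[symmetric], simp, subst Int_absorb1) auto
  finally show ?thesis using assms(3) by (simp add: field_simps)
qed

text \<open>The bins not below average at the start of the window are frozen. On the event none of
  them gains \<open>l\<close> balls, although each is exposed to at least \<open>R\<close> hits of
  probability at least \<open>q\<close>.\<close>

lemma prob_window_le:
  fixes g q :: real and yes P :: "history \<Rightarrow> _"
  assumes "n > 0" "0 \<le> q" "q \<le> 1" "0 \<le> g" "g + 1 \<le> real l"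
    and P: "\<And>h. P h \<Longrightarrow> q \<le> real (heavy n (yes h)) / (real n)\<^sup>2"
  shows "measure_pmf.prob (one_query_process n yes ((m + 1) * n))
    {h. (\<forall>i\<in>{1..n}. real (load (take (m * n) h) i) < m + g) \<and>
        (\<forall>i\<in>{1..n}. real (load h i) < m + 1 + g) \<and> R \<le> visits P (m * n) h}
    \<le> exp (- (real n / (g + 1) * (real (R choose l) * q ^ l * (1 - q) ^ R)))"
    (is "measure_pmf.prob _ ?A \<le> exp (- (_ * ?u))")
proof -
  define s where "s = m * n"
  define C where "C h \<longleftrightarrow> (\<forall>i\<in>{1..n}. real (load h i) < m + g)" for h
  define G where "G h = {i \<in> {1..n}. m \<le> load h i}" for h
  \<comment> \<open>The arguments of each factor are the trials and the balls still missing.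
    Truncated subtraction stops both counts at zero.\<close>
  define Z where "Z h = (if C (take s h) then \<Prod>i\<in>G (take s h).
      binomial_less q (R - visits P s h) (l - (load h i - load (take s h) i)) else 0)" for h
  have u: "0 \<le> ?u" "?u \<le> 1"
    using binomial_less_nonneg[OF assms(2,3), of R l] binomial_less_le[OF assms(2,3), of R l] assms
    by auto
  have finG: "finite (G h)" for h by (simp add: G_def)
  show ?thesis
  proof (rule prob_supermartingale_le[where s = s and Z = Z])
    show "n > 0" "s \<le> (m + 1) * n" by (simp_all add: assms s_def)
  next
    fix h assume h: "h \<in> set_pmf (one_query_process n yes s)"
    note len = set_pmf_one_query_process[OF assms(1) h]
    show "Z h \<le> exp (- (real n / (g + 1) * ?u))"
    proof (cases "C h")
      case True
      have "Z h = binomial_less q R l ^ card (G h)"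
        using True len by (simp add: Z_def)
      also have "\<dots> \<le> exp (- ?u) ^ card (G h)"
      proof (rule power_mono)
        have "binomial_less q R l \<le> 1 - ?u" by (rule binomial_less_le[OF assms(2,3)])
        also have "\<dots> \<le> exp (- ?u)" using exp_ge_add_one_self[of "- ?u"] by simp
        finally show "binomial_less q R l \<le> exp (- ?u)" .
      qed (rule binomial_less_nonneg[OF assms(2,3)])
      also have "\<dots> = exp (- (real (card (G h)) * ?u))"
        by (simp flip: exp_of_nat_mult)
      also have "real n / (g + 1) \<le> card (G h)"
        unfolding G_def using True len assms(4)
        by (intro card_bins_above_average) (auto simp: C_def s_def)
      hence "exp (- (real (card (G h)) * ?u)) \<le> exp (- (real n / (g + 1) * ?u))"
        using mult_right_mono[OF _ u(1)] by (simp only: exp_le_cancel_iff neg_le_iff_le)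
      finally show ?thesis .
    qed (use len in \<open>simp add: Z_def\<close>)
  next
    fix h :: history assume h: "s \<le> length h"
    define h0 r where "h0 = take s h" and "r = R - visits P s h"
    define J where "J i = l - (load h i - load h0 i)" for i
    define r' where "r' = r - of_bool (P h)"
    define f where "f c = (if C h0 then \<Prod>i\<in>G h0. if i = c then binomial_less q r' (J i - 1)
        else binomial_less q r' (J i) else 0)" for c
    have Zh: "Z h = (if C h0 then \<Prod>i\<in>G h0. binomial_less q r (J i) else 0)"
      by (simp add: Z_def h0_def r_def J_def)
    have "Z (h @ [(i, j, c)]) = f c" for i j c
    proof -
      have le: "load h0 b \<le> load h b" for b unfolding h0_def by (rule load_take_le)
      have "l - (load h b + (if b = c then 1 else 0) - load h0 b) = (if b = c then J b - 1 else J b)" for b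
        using le[of b] unfolding J_def by presburger
      thus ?thesis using h
        by (auto simp: Z_def f_def visits_snoc h0_def r_def r'_def intro!: prod.cong)
    qed
    moreover have "f c \<ge> 0" for c
      by (auto simp: f_def intro!: prod_nonneg binomial_less_nonneg assms)
    moreover have "(\<Sum>c\<in>{1..n}. recv n (yes h) c * f c) \<le> Z h"
    proof (cases "C h0")
      case True
      show ?thesis
      \<comment> \<open>A heavy step with trials left consumes one trial. In any other step the
        trial count is unchanged, and a received ball can only lower a factor.\<close>
      proof (cases "P h \<and> r > 0")
        case big: True
        hence r: "r = Suc r'" by (simp add: r'_def)
        have "(\<Sum>c\<in>{1..n}. recv n (yes h) c * f c) \<le>
           (\<Prod>i\<in>G h0. (1 - q) * binomial_less q r' (J i) + q * binomial_less q r' (J i - 1))"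
          unfolding f_def if_P[OF True]
        proof (rule sum_prod_single_hit_le)
          fix i
          show "q \<le> recv n (yes h) i"
            using P[of h] recv_ge[of n "yes h" i] big by linarith
        qed (use assms in \<open>auto simp: G_def sum_recv[unfolded One_nat_def] intro!: binomial_less_mono binomial_less_nonneg\<close>)
        also have "\<dots> = Z h" using True by (simp add: Zh r)
        finally show ?thesis .
      next
        case False
        hence "r' = r" by (auto simp: r'_def)
        hence "f c \<le> Z h" for c
          using True assms by (auto simp: f_def Zh intro!: prod_mono binomial_less_mono binomial_less_nonneg)
        hence "(\<Sum>c\<in>{1..n}. recv n (yes h) c * f c) \<le> (\<Sum>c\<in>{1..n}. recv n (yes h) c * Z h)"
          by (intro sum_mono mult_left_mono recv_nonneg)
        also have "\<dots> = Z h"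
          by (subst sum_distrib_right[symmetric]) (simp only: sum_recv[OF assms(1)] mult_1)
        finally show ?thesis .
      qed
    qed (simp add: f_def Zh)
    ultimately show "\<exists>f. (\<forall>c\<in>{1..n}. f c \<ge> 0 \<and> (\<forall>i j. Z (h @ [(i, j, c)]) \<le> f c)) \<and>
        (\<Sum>c\<in>{1..n}. recv n (yes h) c * f c) \<le> Z h"
      by (intro exI[of _ f]) auto
  next
    fix h assume h: "h \<in> ?A"
    \<comment> \<open>From at least \<open>m\<close> to below \<open>m + 1 + g\<close> is a gain of
      fewer than \<open>l\<close> balls. With no trials left, every factor is therefore 1.\<close>
    have "l - (load h i - load (take s h) i) > 0" if "i \<in> G (take s h)" for i
    proof -
      have "real (load h i) < m + 1 + g" "m \<le> load (take s h) i" using h that by (auto simp: G_def add_ac)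
      moreover from this(1) have "load h i < m + l" using assms(5) by linarith
      ultimately show ?thesis using load_take_le[of s h i] by linarith
    qed
    moreover have "C (take s h)" "R - visits P s h = 0" using h by (auto simp: C_def s_def)
    ultimately show "1 \<le> Z h" by (simp add: Z_def)
  qed auto
qed

section \<open>Few heavy steps\<close>

text \<open>For negative \<open>x\<close>, the product of \<open>1 + x + x^2\<close> and
  \<open>1 - x\<close> is \<open>1 - x^3\<close>, at least 1, while \<open>1 - x\<close> is at most
  \<open>exp (- x)\<close>.\<close>

lemma exp_le_quad:
  fixes x :: real
  assumes "x \<le> 1"
  shows "exp x \<le> 1 + x + x\<^sup>2"
proof (cases "x \<ge> 0")
  case False
  have "1 \<le> 1 + (- x) ^ 3" using False by simp
  also have "\<dots> = (1 + x + x\<^sup>2) * (1 - x)"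
    by (simp add: power2_eq_square power3_eq_cube algebra_simps)
  also have "\<dots> \<le> (1 + x + x\<^sup>2) * exp (- x)"
  proof (rule mult_left_mono)
    have "0 \<le> 3 / 4 + (x + 1 / 2)\<^sup>2" by simp
    also have "\<dots> = 1 + x + x\<^sup>2" by (simp add: power2_eq_square algebra_simps)
    finally show "0 \<le> 1 + x + x\<^sup>2" .
  qed (use exp_ge_add_one_self[of "- x"] in simp)
  finally show ?thesis by (simp add: exp_minus field_simps)
qed (use assms exp_bound in auto)

text \<open>The truncation bounds the slope on both sides given only an upper bound on the deviation
  \<open>y\<close>.\<close>

definition trunc_sq :: "real \<Rightarrow> real \<Rightarrow> real" where
  "trunc_sq g y = (max (y + g) 0)\<^sup>2"

text \<open>The tangent inequality of a convex function.\<close>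

lemma trunc_sq_add_ge: "trunc_sq g y + a * (2 * max (y + g) 0) \<le> trunc_sq g (y + a)"
proof (cases "y + g \<ge> 0")
  case True
  have "(y + g)\<^sup>2 + a * (2 * (y + g)) = (y + g + a)\<^sup>2 - a\<^sup>2"
    by (simp add: power2_eq_square algebra_simps)
  also have "\<dots> \<le> (max (y + a + g) 0)\<^sup>2"
  proof (cases "y + a + g \<ge> 0")
    case False
    hence "\<bar>y + g + a\<bar> \<le> \<bar>a\<bar>" using True by auto
    hence "(y + g + a)\<^sup>2 \<le> a\<^sup>2" by (simp add: abs_le_square_iff)
    thus ?thesis using zero_le_power2[of "max (y + a + g) 0"] by linarith
  qed (simp add: add_ac)
  finally show ?thesis using True by (simp add: trunc_sq_def)
qed (simp add: trunc_sq_def)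

text \<open>An upward move on the untruncated part also earns the exact quadratic term, which is the
  source of the drift.\<close>

lemma trunc_sq_add_ge':
  assumes "a \<ge> 0"
  shows "trunc_sq g y + a * (2 * max (y + g) 0) + a\<^sup>2 * of_bool (y \<ge> - g) \<le> trunc_sq g (y + a)"
proof (cases "y \<ge> - g")
  case True
  hence "max (y + g) 0 = y + g" "max (y + a + g) 0 = y + a + g" using assms by auto
  thus ?thesis using True by (simp add: trunc_sq_def power2_eq_square algebra_simps)
qed (use trunc_sq_add_ge[of g y a] in simp)

definition potential :: "nat \<Rightarrow> real \<Rightarrow> history \<Rightarrow> real" where
  "potential n g h = (\<Sum>i\<in>{1..n}. trunc_sq g (real (load h i) - real (length h) / real n))"

lemma potential_nonneg: "potential n g h \<ge> 0"
  by (simp add: potential_def trunc_sq_def sum_nonneg)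

context
  fixes n :: nat and g :: real and h :: history
begin

definition dev :: "nat \<Rightarrow> real" where
  "dev i = real (load h i) - real (length h) / real n"

definition slope :: "nat \<Rightarrow> real" where
  "slope i = 2 * max (dev i + g) 0"

text \<open>A lower estimate of the change of the potential when \<open>c\<close> receives the ball:
  all bins move down by \<open>1 / n\<close> and \<open>c\<close> moves up by 1. The first-order
  part averages to zero under One-Choice.\<close>

definition gain :: "nat \<Rightarrow> real" where
  "gain c = slope c - (\<Sum>i\<in>{1..n}. slope i) / n + (1 - 1 / n)\<^sup>2 * of_bool (dev c \<ge> - g)"

lemma potential_snoc_ge:
  assumes n: "n > 0" and c: "c \<in> {1..n}"
  shows "potential n g h + gain c \<le> potential n g (h @ [(i, j, c)])"
proof -
  let ?I = "{1..n}"
  define y' where "y' b = real (load (h @ [(i, j, c)]) b) - real (Suc (length h)) / n" for b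
  have y': "y' b = dev b + ((if b = c then 1 else 0) - 1 / n)" for b
    using n by (simp add: y'_def dev_def field_simps)
  have "(\<Sum>b\<in>?I. - 1 / n * slope b) = - ((\<Sum>b\<in>?I. slope b) / n)"
    by (simp add: sum_divide_distrib sum_negf)
  hence "potential n g h + gain c =
      (\<Sum>b\<in>?I. trunc_sq g (dev b)) + (\<Sum>b\<in>?I. - 1 / n * slope b)
       + (\<Sum>b\<in>?I. if b = c then slope c + (1 - 1 / n)\<^sup>2 * of_bool (dev c \<ge> - g) else 0)"
    using c by (simp add: gain_def potential_def dev_def)
  also have "\<dots> = (\<Sum>b\<in>?I. trunc_sq g (dev b) - 1 / n * slope b +
       (if b = c then slope c + (1 - 1 / n)\<^sup>2 * of_bool (dev c \<ge> - g) else 0))"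
    by (simp add: sum.distrib sum_subtractf sum_negf)
  also have "\<dots> \<le> (\<Sum>b\<in>?I. trunc_sq g (y' b))"
  proof (rule sum_mono)
    fix b assume "b \<in> ?I"
    show "trunc_sq g (dev b) - 1 / n * slope b +
       (if b = c then slope c + (1 - 1 / n)\<^sup>2 * of_bool (dev c \<ge> - g) else 0) \<le> trunc_sq g (y' b)"
    proof (cases "b = c")
      case True
      thus ?thesis using trunc_sq_add_ge'[of "1 - 1 / n" g "dev c"] n
        by (simp add: y' slope_def algebra_simps)
    next
      case False
      thus ?thesis using trunc_sq_add_ge[of g "dev b" "- 1 / n"] by (simp add: y' slope_def)
    qed
  qed
  also have "\<dots> = potential n g (h @ [(i, j, c)])"
    by (simp add: potential_def y'_def)
  finally show ?thesis .
qed

context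
  assumes n: "n \<ge> 8" and g: "g > 0" and dev_less: "\<And>i. i \<in> {1..n} \<Longrightarrow> dev i < g"
begin

lemma slope_bounds: "i \<in> {1..n} \<Longrightarrow> 0 \<le> slope i \<and> slope i \<le> 4 * g"
  using dev_less[of i] g by (auto simp: slope_def)

lemma sum_slope_bounds: "0 \<le> (\<Sum>i\<in>{1..n}. slope i) / n" "(\<Sum>i\<in>{1..n}. slope i) / n \<le> 4 * g"
proof -
  have "(\<Sum>i\<in>{1..n}. slope i) \<le> (\<Sum>i\<in>{1..n}. 4 * g)"
    by (intro sum_mono) (use slope_bounds in auto)
  thus "(\<Sum>i\<in>{1..n}. slope i) / n \<le> 4 * g" using n by (simp add: field_simps)
  show "0 \<le> (\<Sum>i\<in>{1..n}. slope i) / n"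
    by (intro divide_nonneg_nonneg sum_nonneg) (use slope_bounds in auto)
qed

lemma abs_gain_le:
  assumes "c \<in> {1..n}"
  shows "\<bar>gain c\<bar> \<le> 4 * g + 1"
proof -
  have "(1 - 1 / real n)\<^sup>2 \<le> 1" using n by (intro power_le_one) auto
  hence "0 \<le> (1 - 1 / real n)\<^sup>2 * of_bool (dev c \<ge> - g)" "(1 - 1 / real n)\<^sup>2 * of_bool (dev c \<ge> - g) \<le> 1"
    by auto
  thus ?thesis unfolding gain_def abs_le_iff
    using slope_bounds[OF assms] sum_slope_bounds by linarith
qed

text \<open>Deviations sum to zero and stay below \<open>g\<close>, so at least half of them exceed \<open>- g\<close>.\<close>

lemma sum_recv_gain_ge:
  assumes len: "(\<Sum>i\<in>{1..n}. load h i) = length h" and \<mu>: "\<mu> = real (heavy n Y) / real n"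
  shows "- 4 * g * \<mu> + (1 - 1 / n)\<^sup>2 * max 0 (1 / 2 - \<mu>) \<le> (\<Sum>c\<in>{1..n}. recv n Y c * gain c)"
proof -
  let ?I = "{1..n}"
  let ?e = "\<lambda>i. of_bool (dev i \<ge> - g) :: real"
  have n0: "n > 0" using n by simp
  have \<mu>0: "0 \<le> \<mu>" by (simp add: \<mu>)
  have "(0::real) = (\<Sum>i\<in>?I. dev i)"
    using n0 arg_cong[OF len, of real] by (simp add: dev_def sum_subtractf)
  \<comment> \<open>A deviation is below \<open>g\<close> if the indicator is 1 and below
    \<open>- g\<close> if it is 0.\<close>
  also have "\<dots> \<le> (\<Sum>i\<in>?I. 2 * g * ?e i - g)"
  proof (rule sum_mono)
    fix i assume "i \<in> ?I"
    thus "dev i \<le> 2 * g * ?e i - g" using dev_less[of i] g by auto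
  qed
  also have "\<dots> = g * (2 * (\<Sum>i\<in>?I. ?e i) - n)"
    by (simp add: sum_subtractf algebra_simps flip: sum_distrib_left sum_distrib_right del: sum_of_bool_eq sum_mult_of_bool_eq sum_of_bool_mult_eq)
  finally have e: "(\<Sum>i\<in>?I. ?e i) / n \<ge> 1 / 2"
    using g n0 by (simp add: zero_le_mult_iff field_simps del: sum_of_bool_eq)
  have "(\<Sum>i\<in>?I. of_bool (Y i) * ?e i) \<le> (\<Sum>i\<in>?I. of_bool (Y i))"
    by (intro sum_mono) auto
  hence "(\<Sum>i\<in>?I. of_bool (Y i) * ?e i) / n \<le> \<mu>"
    unfolding \<mu> heavy_sum by (rule divide_right_mono) auto
  moreover have "0 \<le> \<mu> * ((\<Sum>i\<in>?I. ?e i) / n)" using e \<mu>0 by (intro mult_nonneg_nonneg) auto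
  ultimately have "1 / 2 - \<mu> \<le> (\<Sum>c\<in>?I. recv n Y c * ?e c)"
    unfolding sum_recv_mult[OF n0] \<mu>[symmetric] using e by linarith
  moreover have "0 \<le> (\<Sum>c\<in>?I. recv n Y c * ?e c)"
    by (intro sum_nonneg mult_nonneg_nonneg recv_nonneg) auto
  ultimately have E: "(1 - 1 / n)\<^sup>2 * max 0 (1 / 2 - \<mu>) \<le> (1 - 1 / n)\<^sup>2 * (\<Sum>c\<in>?I. recv n Y c * ?e c)"
    by (intro mult_left_mono) auto
  \<comment> \<open>The first-order loss against One-Choice comes from the yes bins, a fraction
    \<mu> of all bins with slopes at most \<open>4 * g\<close>.\<close>
  have "(\<Sum>i\<in>?I. of_bool (Y i) * slope i) \<le> (\<Sum>i\<in>?I. of_bool (Y i) * (4 * g))"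
    by (intro sum_mono mult_left_mono) (use slope_bounds in auto)
  also have "\<dots> = 4 * g * real (heavy n Y)"
    by (simp only: heavy_sum sum_distrib_right[symmetric] mult.commute)
  finally have "(\<Sum>i\<in>?I. of_bool (Y i) * slope i) / n \<le> 4 * g * real (heavy n Y) / n"
    by (rule divide_right_mono) auto
  hence "(\<Sum>i\<in>?I. of_bool (Y i) * slope i) / n \<le> 4 * g * \<mu>" by (simp add: \<mu>)
  moreover have "0 \<le> \<mu> * ((\<Sum>i\<in>?I. slope i) / n)"
    using \<mu>0 sum_slope_bounds by (intro mult_nonneg_nonneg) auto
  ultimately have D: "(\<Sum>i\<in>?I. slope i) / n - 4 * g * \<mu> \<le> (\<Sum>c\<in>?I. recv n Y c * slope c)"
    unfolding sum_recv_mult[OF n0] \<mu>[symmetric] by linarith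
  have "(\<Sum>c\<in>?I. recv n Y c * gain c) = (\<Sum>c\<in>?I. recv n Y c * slope c)
      - (\<Sum>c\<in>?I. recv n Y c) * ((\<Sum>i\<in>?I. slope i) / n) + (1 - 1 / n)\<^sup>2 * (\<Sum>c\<in>?I. recv n Y c * ?e c)"
    unfolding gain_def sum_distrib_left sum_distrib_right sum_subtractf[symmetric] sum.distrib[symmetric]
    by (intro sum.cong refl) (simp add: algebra_simps)
  thus ?thesis using D E unfolding sum_recv[OF n0] by linarith
qed

text \<open>With this \<kappa> the quadratic remainder of the exponential is at most
  \<open>\<kappa> / 8\<close>. A light step has drift at least \<open>1 / 4\<close>, hence a net
  gain of \<open>1 / 8\<close>; a heavy step has drift at least \<open>- 4 * g\<close>.\<close>

lemma sum_recv_exp_gain_le: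
  assumes len: "(\<Sum>i\<in>{1..n}. load h i) = length h"
    and \<theta>: "(4 * g + 1) * \<theta> \<le> 1 / 16" and \<kappa>: "\<kappa> = 1 / (8 * (4 * g + 1)\<^sup>2)"
  shows "(\<Sum>c\<in>{1..n}. recv n Y c * exp (- \<kappa> * gain c)) \<le>
    exp (if \<theta> \<le> real (heavy n Y) / n then \<kappa> * (4 * g + 1) else - \<kappa> / 8)"
proof -
  let ?I = "{1..n}" and ?K = "4 * g + 1"
  define \<mu> where "\<mu> = real (heavy n Y) / real n"
  have n0: "n > 0" using n by simp
  have K: "?K \<ge> 1" using g by simp
  have \<kappa>0: "\<kappa> > 0" using K by (simp add: \<kappa>)
  have \<mu>1: "0 \<le> \<mu>" "\<mu> \<le> 1" using heavy_le[of n Y] n0 by (auto simp: \<mu>_def)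
  have "\<kappa> * ?K\<^sup>2 = 1 / 8" using K by (simp add: \<kappa>)
  moreover have "(\<kappa> * ?K)\<^sup>2 = \<kappa> * (\<kappa> * ?K\<^sup>2)" by (simp only: power2_eq_square mult_ac)
  ultimately have \<kappa>K2: "(\<kappa> * ?K)\<^sup>2 = \<kappa> / 8" by simp
  have "?K * 1 \<le> ?K\<^sup>2" unfolding power2_eq_square using K by (intro mult_left_mono) auto
  hence \<kappa>K: "\<kappa> * ?K \<le> 1" using K by (simp add: \<kappa>)
  have exp_le: "exp (- \<kappa> * gain c) \<le> 1 - \<kappa> * gain c + \<kappa> / 8" if c: "c \<in> ?I" for c
  proof -
    have "\<bar>\<kappa> * gain c\<bar> \<le> \<kappa> * ?K"
      using abs_gain_le[OF c] \<kappa>0 by (simp add: abs_mult)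
    hence "\<bar>- \<kappa> * gain c\<bar> \<le> 1" "(\<kappa> * gain c)\<^sup>2 \<le> (\<kappa> * ?K)\<^sup>2"
      using \<kappa>K by (auto simp: abs_le_square_iff[symmetric] intro: order_trans)
    thus ?thesis using exp_le_quad[of "- \<kappa> * gain c"] \<kappa>K2 by (simp add: abs_le_iff)
  qed
  have "(\<Sum>c\<in>?I. recv n Y c * exp (- \<kappa> * gain c)) \<le> (\<Sum>c\<in>?I. recv n Y c * (1 - \<kappa> * gain c + \<kappa> / 8))"
    by (intro sum_mono mult_left_mono exp_le recv_nonneg)
  also have "\<dots> = (\<Sum>c\<in>?I. recv n Y c) * (1 + \<kappa> / 8) - \<kappa> * (\<Sum>c\<in>?I. recv n Y c * gain c)"
    unfolding sum_distrib_left sum_distrib_right sum_subtractf[symmetric]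
    by (intro sum.cong refl) (simp add: algebra_simps)
  also have "\<dots> = 1 + \<kappa> * (1 / 8 - (\<Sum>c\<in>?I. recv n Y c * gain c))"
    unfolding sum_recv[OF n0] by (simp add: algebra_simps)
  also have "\<dots> \<le> 1 + \<kappa> * (if \<theta> \<le> \<mu> then ?K else - 1 / 8)"
  proof -
    have E: "- 4 * g * \<mu> + (1 - 1 / n)\<^sup>2 * max 0 (1 / 2 - \<mu>) \<le> (\<Sum>c\<in>?I. recv n Y c * gain c)"
      by (rule sum_recv_gain_ge[OF len \<mu>_def])
    have "1 / 8 - (\<Sum>c\<in>?I. recv n Y c * gain c) \<le> (if \<theta> \<le> \<mu> then ?K else - 1 / 8)"
    proof (cases "\<theta> \<le> \<mu>")
      case True
      have "4 * g * \<mu> \<le> 4 * g * 1" using \<mu>1 g by (intro mult_left_mono) auto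
      moreover have "0 \<le> (1 - 1 / n)\<^sup>2 * max 0 (1 / 2 - \<mu>)" by simp
      ultimately show ?thesis unfolding if_P[OF True] using E by linarith
    next
      case False
      have "?K * \<mu> \<le> ?K * \<theta>" using False K by (intro mult_left_mono) auto
      hence K\<mu>: "4 * g * \<mu> + \<mu> \<le> 1 / 16" using \<theta> by (simp add: algebra_simps)
      have "0 \<le> 4 * g * \<mu>" using g \<mu>1 by simp
      with K\<mu> have \<mu>2: "\<mu> \<le> 1 / 16" by linarith
      have "1 - 1 / real n \<ge> 7 / 8" using n by (simp add: field_simps)
      hence "(1 - 1 / n)\<^sup>2 \<ge> (7 / 8)\<^sup>2" by (intro power_mono) auto
      hence "(1 - 1 / n)\<^sup>2 * max 0 (1 / 2 - \<mu>) \<ge> (7 / 8)\<^sup>2 * (7 / 16)"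
        using \<mu>2 by (intro mult_mono) auto
      \<comment> \<open>The second-order gain \<open>5 / 16\<close> minus the first-order loss of at
        most \<open>1 / 16\<close> leaves the drift \<open>1 / 4\<close>.\<close>
      moreover have "5 / 16 \<le> (7 / 8 :: real)\<^sup>2 * (7 / 16)" by (simp add: power2_eq_square)
      ultimately show ?thesis unfolding if_not_P[OF False] using E K\<mu> \<mu>1 by linarith
    qed
    thus ?thesis using \<kappa>0 by (intro add_left_mono mult_left_mono) auto
  qed
  also have "\<dots> \<le> exp (\<kappa> * (if \<theta> \<le> \<mu> then ?K else - 1 / 8))"
    by (rule exp_ge_add_one_self)
  also have "\<dots> = exp (if \<theta> \<le> real (heavy n Y) / n then \<kappa> * ?K else - \<kappa> / 8)"
    by (simp add: \<mu>_def)
  finally show ?thesis .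
qed

end

end

text \<open>Each light step credits \<open>1 / 8\<close> and each heavy step debits
  \<open>K\<close>, hence the coefficient \<open>K + 1 / 8\<close> of the heavy count. Few heavy
  steps would force the potential above the maximum allowed by the gap.\<close>

lemma prob_few_heavy_le:
  fixes g \<theta> :: real and V :: nat
  defines "K \<equiv> 4 * g + 1"
  assumes n: "n \<ge> 8" and g: "g > 0" and \<theta>: "K * \<theta> \<le> 1 / 16"
  shows "measure_pmf.prob (one_query_process n yes T)
    {h. (\<forall>r\<le>T. \<forall>i\<in>{1..n}. real (load (take r h) i) < real r / real n + g) \<and>
        visits (\<lambda>h. \<theta> \<le> real (heavy n (yes h)) / n) 0 h \<le> V}
    \<le> exp (- ((T / 8 - (K + 1 / 8) * V - 4 * n * g\<^sup>2) / (8 * K\<^sup>2)))"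
    (is "measure_pmf.prob _ ?A \<le> _")
proof -
  define P where "P = (\<lambda>h. \<theta> \<le> real (heavy n (yes h)) / n)"
  define \<kappa> where "\<kappa> = 1 / (8 * K\<^sup>2)"
  \<comment> \<open>\<open>E\<close> is a lower bound for the final exponent on the event, so
    subtracting it makes \<open>Z\<close> at least 1 there.\<close>
  define E where "E = \<kappa> * (T / 8 - (K + 1 / 8) * V - 4 * n * g\<^sup>2)"
  define C where "C h \<longleftrightarrow> (\<forall>i\<in>{1..n}. real (load h i) < real (length h) / n + g)" for h
  \<comment> \<open>The moment estimate needs the gap bound at the start of the step; once that
    fails, \<open>Z\<close> is 0 after the step.\<close>
  define D where "D h \<longleftrightarrow> (\<forall>r<length h. C (take r h))" for h
  define Z where "Z h = (if D h then
      exp (\<kappa> * (length h / 8 - (K + 1 / 8) * visits P 0 h - potential n g h) - E) else 0)" for h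
  have n0: "n > 0" using n by simp
  have \<kappa>0: "\<kappa> \<ge> 0" by (simp add: \<kappa>_def)
  have D_snoc: "D (h @ [x]) \<longleftrightarrow> D h \<and> C h" for h x
    by (auto simp: D_def less_Suc_eq)
  have "measure_pmf.prob (one_query_process n yes T) ?A \<le> exp (- E)"
  proof (rule prob_supermartingale_le[where s = 0 and Z = Z])
    fix h assume "h \<in> set_pmf (one_query_process n yes 0)"
    hence "h = []" by simp
    thus "Z h \<le> exp (- E)"
      using \<kappa>0 by (simp add: Z_def potential_nonneg)
  next
    fix h assume h: "h \<in> set_pmf (one_query_process n yes (length h))"
    \<comment> \<open>The entry \<open>undefined\<close> is a placeholder: the new length and the
      new count do not depend on the ball.\<close>
    define W where "W = exp (\<kappa> * (length (h @ [undefined]) / 8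
       - (K + 1 / 8) * visits P 0 (h @ [undefined]) - potential n g h) - E)"
    define f where "f c = (if D h \<and> C h then W * exp (- \<kappa> * gain n g h c) else 0)" for c
    have W: "W = exp (\<kappa> * (length h / 8 - (K + 1 / 8) * visits P 0 h - potential n g h) - E) *
        exp (- (if P h then \<kappa> * K else - \<kappa> / 8))"
      by (simp add: W_def visits_snoc flip: exp_add) (simp add: algebra_simps add_divide_distrib)
    have "Z (h @ [(i, j, c)]) \<le> f c" if "c \<in> {1..n}" for i j c
    proof -
      have "\<kappa> * (potential n g h + gain n g h c) \<le> \<kappa> * potential n g (h @ [(i, j, c)])"
        using potential_snoc_ge[OF n0 that] \<kappa>0 by (rule mult_left_mono)
      thus ?thesis
        by (auto simp: Z_def f_def W_def D_snoc visits_snoc algebra_simps add_divide_distrib simp flip: exp_add)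
    qed
    moreover have "f c \<ge> 0" for c by (simp add: f_def W_def)
    moreover have "(\<Sum>c\<in>{1..n}. recv n (yes h) c * f c) \<le> Z h"
    proof (cases "D h \<and> C h")
      case True
      have dev: "dev n h i < g" if "i \<in> {1..n}" for i
        using True that by (force simp: C_def dev_def)
      have "(\<Sum>c\<in>{1..n}. recv n (yes h) c * f c) =
          W * (\<Sum>c\<in>{1..n}. recv n (yes h) c * exp (- \<kappa> * gain n g h c))"
        using True by (simp add: f_def sum_distrib_left mult_ac)
      also have "\<dots> \<le> W * exp (if P h then \<kappa> * K else - \<kappa> / 8)"
        unfolding P_def K_def
        using sum_recv_exp_gain_le[OF n g dev sum_load \<theta>[unfolded K_def] \<kappa>_def[unfolded K_def]]
          set_pmf_one_query_process(2)[OF n0 h]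
        by (intro mult_left_mono) (auto simp: W_def)
      also have "\<dots> = Z h"
        using True by (simp add: W Z_def flip: exp_add)
      finally show ?thesis .
    qed (auto simp: f_def Z_def)
    ultimately show "\<exists>f. (\<forall>c\<in>{1..n}. f c \<ge> 0 \<and> (\<forall>i j. Z (h @ [(i, j, c)]) \<le> f c)) \<and>
        (\<Sum>c\<in>{1..n}. recv n (yes h) c * f c) \<le> Z h"
      by (intro exI[of _ f]) auto
  next
    fix h assume h: "h \<in> ?A" and supp: "h \<in> set_pmf (one_query_process n yes T)"
    have len: "length h = T" using set_pmf_one_query_process(1)[OF n0 supp] .
    have D: "D h" using h by (auto simp: D_def C_def len)
    have "potential n g h \<le> (\<Sum>i\<in>{1..n}. (2 * g)\<^sup>2)"
      unfolding potential_def trunc_sq_def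
    proof (intro sum_mono power_mono)
      fix i assume i: "i \<in> {1..n}"
      have "real (load h i) < real T / n + g" using h i len by force
      thus "max (real (load h i) - real (length h) / real n + g) 0 \<le> 2 * g"
        using g len by simp
    qed auto
    also have "\<dots> = 4 * n * g\<^sup>2" by (simp add: power2_eq_square)
    finally have "potential n g h \<le> 4 * n * g\<^sup>2" .
    moreover have "(K + 1 / 8) * visits P 0 h \<le> (K + 1 / 8) * V"
      using h g by (intro mult_left_mono) (auto simp: P_def K_def)
    ultimately have "E \<le> \<kappa> * (length h / 8 - (K + 1 / 8) * visits P 0 h - potential n g h)"
      unfolding E_def len using \<kappa>0 by (intro mult_left_mono) auto
    thus "1 \<le> Z h" using D by (simp add: Z_def)
  qed (use n0 in auto)
  thus ?thesis by (simp add: E_def \<kappa>_def)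
qed

section \<open>The union bound over the windows\<close>

lemma visits_take_split:
  assumes "s \<le> u" "u \<le> t" "t \<le> length h"
  shows "visits P s (take t h) = visits P s (take u h) + visits P u (take t h)"
proof -
  have take: "take k (take v h) = take k h" if "k < v" for k v
    using that by (simp add: min_absorb1)
  have V: "visits P a (take v h) = card {k \<in> {a..<v}. P (take k h)}" if "v \<le> length h" for a v
    unfolding visits_def using that by (intro arg_cong[where f = card]) (auto simp: take min_absorb2)
  have "{k \<in> {s..<t}. P (take k h)} = {k \<in> {s..<u}. P (take k h)} \<union> {k \<in> {u..<t}. P (take k h)}"
    using assms by auto
  moreover have "card ({k \<in> {s..<u}. P (take k h)} \<union> {k \<in> {u..<t}. P (take k h)}) =
      card {k \<in> {s..<u}. P (take k h)} + card {k \<in> {u..<t}. P (take k h)}"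
    by (intro card_Un_disjoint) auto
  ultimately show ?thesis using assms by (simp add: V)
qed

lemma visits_windows_le:
  assumes "W * n \<le> length h" "\<And>m. m < W \<Longrightarrow> visits P (m * n) (take ((m + 1) * n) h) \<le> R"
  shows "visits P 0 (take (W * n) h) \<le> W * R"
  using assms
proof (induction W)
  case (Suc W)
  have "visits P 0 (take (Suc W * n) h) =
      visits P 0 (take (W * n) h) + visits P (W * n) (take ((W + 1) * n) h)"
    using Suc.prems(1) by (subst visits_take_split[of 0 "W * n"]) auto
  also have "\<dots> \<le> W * R + R"
    using Suc.prems by (intro add_mono Suc.IH) auto
  finally show ?case by simp
qed simp

text \<open>Either one of the \<open>W\<close> windows has at least \<open>R\<close> heavy steps, or
  there are at most \<open>W * R\<close> of them altogether. The union bound adds the two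
  estimates.\<close>

lemma prob_small_gap_le:
  fixes g \<theta> :: real and n W H :: nat
  assumes n: "n \<ge> 8" and g: "g > 0" and \<theta>: "0 \<le> \<theta>" "(4 * g + 1) * \<theta> \<le> 1 / 16" and l: "g + 1 \<le> real l"
    and W: "W * n \<le> H"
  shows "measure_pmf.prob (one_query_process n yes H) {h. \<forall>t\<in>{1..H}. Gap n h t < g}
    \<le> W * exp (- (real n / (g + 1) * (real (R choose l) * (\<theta> / n) ^ l * (1 - \<theta> / n) ^ R)))
     + exp (- (((W * n) / 8 - (4 * g + 1 + 1 / 8) * (W * R) - 4 * n * g\<^sup>2) / (8 * (4 * g + 1)\<^sup>2)))"
    (is "_ \<le> real W * ?a + ?b")
proof -
  let ?prob = "\<lambda>t. measure_pmf.prob (one_query_process n yes t)"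
  let ?bad = "{h. \<forall>t\<in>{1..H}. Gap n h t < g}"
  have n0: "n > 0" using n by simp
  have "1 * \<theta> \<le> (4 * g + 1) * \<theta>" using \<theta>(1) g by (intro mult_right_mono) auto
  hence "\<theta> \<le> 1 * real n" using \<theta>(2) n by linarith
  hence q: "0 \<le> \<theta> / n" "\<theta> / n \<le> 1" using \<theta>(1) n0 by (auto simp: field_simps)
  define P where "P = (\<lambda>h. \<theta> \<le> real (heavy n (yes h)) / n)"
  have P: "\<theta> / n \<le> real (heavy n (yes h)) / (real n)\<^sup>2" if "P h" for h
    using divide_right_mono[OF that[unfolded P_def], of n] by (simp add: power2_eq_square)
  define A where "A m = {h. (\<forall>i\<in>{1..n}. real (load (take (m * n) h) i) < m + g) \<and>
        (\<forall>i\<in>{1..n}. real (load h i) < m + 1 + g) \<and> R \<le> visits P (m * n) h}" for m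
  define B where "B = {h. (\<forall>r\<le>W * n. \<forall>i\<in>{1..n}. real (load (take r h) i) < real r / n + g) \<and>
        visits P 0 h \<le> W * R}"
  let ?p = "one_query_process n yes H"
  have windows: "(m + 1) * n \<le> H" if "m < W" for m
    using W mult_le_mono1[of "m + 1" W n] that by linarith
  have bad: "?bad \<inter> set_pmf ?p \<subseteq> (\<Union>m<W. {h. take ((m + 1) * n) h \<in> A m}) \<union> {h. take (W * n) h \<in> B}"
  proof
    fix h assume h: "h \<in> ?bad \<inter> set_pmf ?p"
    have len: "length h = H" using h set_pmf_one_query_process(1)[OF n0] by auto
    \<comment> \<open>The gap event covers only positive times; time 0, where the first window
      starts, is trivial since \<open>g > 0\<close>.\<close>
    have load: "real (load (take t h) i) < real t / n + g" if "t \<le> H" "i \<in> {1..n}" for t i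
    proof (cases "t = 0")
      case False
      have "load (take t h) i \<le> (MAX i\<in>{1..n}. load (take t h) i)"
        using that by (intro Max_ge) auto
      moreover have "Gap n h t < g" using h that False by auto
      ultimately show ?thesis unfolding Gap_def by linarith
    qed (use g in simp)
    show "h \<in> (\<Union>m<W. {h. take ((m + 1) * n) h \<in> A m}) \<union> {h. take (W * n) h \<in> B}"
    proof (cases "\<exists>m<W. R \<le> visits P (m * n) (take ((m + 1) * n) h)")
      case True
      then obtain m where m: "m < W" "R \<le> visits P (m * n) (take ((m + 1) * n) h)" by auto
      have "real (load (take (m * n) (take ((m + 1) * n) h)) i) < m + g"
        "real (load (take ((m + 1) * n) h) i) < real m + 1 + g" if "i \<in> {1..n}" for i
        using load[of "m * n" i] load[of "(m + 1) * n" i] windows[OF m(1)] that n0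
        by (auto simp: min_absorb1 add_divide_distrib)
      hence "take ((m + 1) * n) h \<in> A m"
        unfolding A_def mem_Collect_eq using m(2) by (intro conjI ballI) auto
      thus ?thesis using m(1) by blast
    next
      case False
      hence "visits P 0 (take (W * n) h) \<le> W * R"
        using W len by (intro visits_windows_le) (auto simp: not_le)
      moreover have "real (load (take r (take (W * n) h)) i) < real r / n + g"
        if "r \<le> W * n" "i \<in> {1..n}" for r i
        using load[of r i] that W by (simp add: min_absorb1)
      ultimately show ?thesis by (auto simp: B_def)
    qed
  qed
  have "?prob H ?bad = ?prob H (?bad \<inter> set_pmf ?p)"
    by (simp add: measure_Int_set_pmf)
  also have "\<dots> \<le> ?prob H ((\<Union>m<W. {h. take ((m + 1) * n) h \<in> A m}) \<union> {h. take (W * n) h \<in> B})"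
    by (intro measure_pmf.finite_measure_mono bad) auto
  also have "\<dots> \<le> ?prob H (\<Union>m<W. {h. take ((m + 1) * n) h \<in> A m}) + ?prob H {h. take (W * n) h \<in> B}"
    by (intro measure_Un_le) auto
  also have "\<dots> \<le> (\<Sum>m<W. ?prob H {h. take ((m + 1) * n) h \<in> A m}) + ?prob H {h. take (W * n) h \<in> B}"
    by (intro add_right_mono measure_UNION_le) auto
  also have "\<dots> = (\<Sum>m<W. ?prob ((m + 1) * n) (A m)) + ?prob (W * n) B"
    using W windows by (intro arg_cong2[where f = "(+)"] sum.cong prob_take_one_query_process n0 refl) auto
  also have "\<dots> \<le> (\<Sum>m<W. ?a) + ?b"
  proof (intro add_mono sum_mono)
    fix m
    show "?prob ((m + 1) * n) (A m) \<le> ?a"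
      unfolding A_def using n0 q g l P by (intro prob_window_le) auto
    show "?prob (W * n) B \<le> ?b"
      using prob_few_heavy_le[OF n g \<theta>(2), of yes "W * n" "W * R"] by (simp add: B_def P_def)
  qed
  finally show ?thesis by simp
qed

section \<open>Asymptotic estimates and conclusion\<close>

text \<open>As the binomial coefficient is at least \<open>(R / l) ^ l\<close>, each of the
  \<open>l\<close> hits costs at most a factor \<open>L ^ 5\<close>. Since \<open>l\<close> is at
  most \<open>g + 2\<close> and \<open>g * ln L = L / 8\<close>, the total cost is at most
  \<open>exp (5 / 8 * L + 10 * ln L)\<close>; for \<open>L = ln n\<close> this leaves a positive
  power of \<open>n\<close>.\<close>

lemma exponent_window_ge:
  fixes L :: real and n :: nat
  defines "\<theta> \<equiv> 1 / L\<^sup>2" and "g \<equiv> L / (8 * ln L)"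
  defines "R \<equiv> nat \<lceil>real n * \<theta>\<rceil>" and "l \<equiv> nat \<lceil>g + 1\<rceil>"
  assumes "n > 0" "L > 2" "g + 2 \<le> L" "L \<le> real n * \<theta>" "real n * \<theta> + 1 \<le> real n"
  shows "real n / L * exp (- 5 / 8 * L - 10 * ln L) / 2
     \<le> real n / (g + 1) * (real (R choose l) * (\<theta> / n) ^ l * (1 - \<theta> / n) ^ R)"
proof -
  have lnL: "ln L > 0" using assms by simp
  have g: "g > 0" using lnL assms by (simp add: g_def)
  have L2: "L\<^sup>2 \<ge> 4" using power_mono[of 2 L 2] assms by simp
  have l: "g + 1 \<le> l" "l \<le> g + 2" "l > 0" using g unfolding l_def by linarith+
  have R: "n * \<theta> \<le> R" "R \<le> n * \<theta> + 1" using assms(8) \<open>L > 2\<close> unfolding R_def by linarith+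
  have lR: "l \<le> R" using l R assms by linarith
  have \<theta>: "0 < \<theta>" "\<theta> \<le> 1 / 4" using L2 \<open>L > 2\<close> by (auto simp: \<theta>_def field_simps)
  have "1 / L ^ 5 \<le> real R * (\<theta> / n) / l"
  proof -
    have "1 / L ^ 5 = (n * \<theta>) * (\<theta> / n) / L"
      using assms(5,6) by (simp add: \<theta>_def field_simps eval_nat_numeral)
    also have "\<dots> \<le> real R * (\<theta> / n) / l"
      using R l assms(5-7) \<theta> by (intro frac_le mult_right_mono) auto
    finally show ?thesis .
  qed
  hence "(1 / L ^ 5) ^ l \<le> (real R * (\<theta> / n) / l) ^ l"
    using assms(6) by (intro power_mono) auto
  also have "\<dots> = (real R / l) ^ l * (\<theta> / n) ^ l"
    by (simp add: power_mult_distrib power_divide)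
  also have "\<dots> \<le> real (R choose l) * (\<theta> / n) ^ l"
    using \<theta> binomial_ge_n_over_k_pow_k[OF lR, where 'a = real] by (intro mult_right_mono) auto
  finally have bin: "(1 / L ^ 5) ^ l \<le> real (R choose l) * (\<theta> / n) ^ l" .
  have "exp (- 5 / 8 * L - 10 * ln L) = exp (- 5 * (g + 2) * ln L)"
    using lnL by (simp add: g_def algebra_simps)
  also have "\<dots> \<le> exp (- 5 * l * ln L)"
  proof -
    have "l * ln L \<le> (g + 2) * ln L" using l lnL by (intro mult_right_mono) auto
    thus ?thesis unfolding exp_le_cancel_iff mult.assoc by linarith
  qed
  also have "\<dots> = (1 / L ^ 5) ^ l"
  proof -
    have "1 / L ^ 5 = exp (- 5 * ln L)"
      using exp_of_nat_mult[of 5 "ln L"] \<open>L > 2\<close> by (simp add: exp_minus field_simps)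
    thus ?thesis by (simp add: algebra_simps flip: exp_of_nat_mult)
  qed
  finally have E: "exp (- 5 / 8 * L - 10 * ln L) \<le> real (R choose l) * (\<theta> / n) ^ l"
    using bin by linarith
  \<comment> \<open>By Bernoulli's inequality the failure factor
    \<open>(1 - \<theta> / n) ^ R\<close> costs at most one half.\<close>
  have "1 / 2 \<le> 1 - real R * (\<theta> / n)"
  proof -
    have "real R \<le> real n" using R(2) assms(9) by linarith
    hence "real R * (\<theta> / n) \<le> real n * (\<theta> / n)" using \<theta> by (intro mult_right_mono) auto
    also have "\<dots> = \<theta>" using \<open>n > 0\<close> by simp
    finally show ?thesis using \<theta>(2) by linarith
  qed
  also have "\<dots> \<le> (1 - \<theta> / n) ^ R"
  proof -
    have "\<theta> / n \<le> 1" using \<theta> \<open>n > 0\<close> by (simp add: field_simps)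
    thus ?thesis using Bernoulli_inequality[of "- (\<theta> / n)" R] by simp
  qed
  finally have half: "1 / 2 \<le> (1 - \<theta> / n) ^ R" .
  have "n / L * (exp (- 5 / 8 * L - 10 * ln L) * (1 / 2))
     \<le> real n / (g + 1) * (real (R choose l) * (\<theta> / n) ^ l * (1 - \<theta> / n) ^ R)"
    using E half assms(5-7) g \<theta> by (intro mult_mono frac_le mult_nonneg_nonneg) auto
  thus ?thesis by simp
qed

lemma prob_large_gap_ge:
  "\<forall>\<^sub>F n in sequentially. \<forall>yes.
     1 - ((ln n)\<^sup>2 + 1) * exp (- (real n powr (1 / 4)))
       \<le> measure_pmf.prob (one_query_process n yes (horizon n)) (large_gap n)"
proof -
  have *: "\<forall>\<^sub>F n in sequentially. n \<ge> (8 :: nat)"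
    "\<forall>\<^sub>F n in sequentially. ln (real n) > 2"
    "\<forall>\<^sub>F n in sequentially. (4 * (ln (real n) / (8 * ln (ln (real n)))) + 1) * (1 / (ln (real n))\<^sup>2) \<le> 1 / 16"
    "\<forall>\<^sub>F n in sequentially. ln (real n) / (8 * ln (ln (real n))) + 2 \<le> ln (real n)"
    "\<forall>\<^sub>F n in sequentially. ln (real n) \<le> real n * (1 / (ln (real n))\<^sup>2)"
    "\<forall>\<^sub>F n in sequentially. real n * (1 / (ln (real n))\<^sup>2) + 1 \<le> real n"
    "\<forall>\<^sub>F n in sequentially. real n powr (1 / 4) \<le>
        n / ln (real n) * exp (- 5 / 8 * ln (real n) - 10 * ln (ln (real n))) / 2"
    \<comment> \<open>With \<open>L = ln n\<close>, the term of order \<open>n * L^2\<close>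
      dominates the heavy steps and the maximal potential, because \<open>g\<close> is of order
      \<open>L / ln L\<close>. After division by order \<open>g^2\<close> the exponent is still of
      order \<open>n * (ln L)^2\<close>.\<close>
    "\<forall>\<^sub>F n in sequentially. real n powr (1 / 4) \<le>
        ((n * (ln (real n))\<^sup>2 - 1 - n) / 8
          - (4 * (ln (real n) / (8 * ln (ln (real n)))) + 1 + 1 / 8) * (n + (ln (real n))\<^sup>2)
          - 4 * n * (ln (real n) / (8 * ln (ln (real n))))\<^sup>2)
         / (8 * (4 * (ln (real n) / (8 * ln (ln (real n)))) + 1)\<^sup>2)"
    by real_asymp+
  show ?thesis
    using *
  proof eventually_elim
    case (elim n)
    define L where "L = ln (real n)"
    define g where "g = L / (8 * ln L)"
    define \<theta> where "\<theta> = 1 / L\<^sup>2"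
    define R where "R = nat \<lceil>n * \<theta>\<rceil>"
    define l where "l = nat \<lceil>g + 1\<rceil>"
    define W where "W = horizon n div n"
    note c = elim[folded L_def, folded g_def \<theta>_def]
    have lnL: "ln L > 0" using c by simp
    have g: "g > 0" using lnL c by (simp add: g_def)
    have n0: "n > 0" using c by simp
    have L0: "L > 0" using c by simp
    have WH: "W * n \<le> horizon n" by (simp add: W_def)
    have H: "real (horizon n) \<le> n * L\<^sup>2" "n * L\<^sup>2 \<le> real (horizon n) + 1"
      unfolding horizon_def L_def[symmetric] using n0 L0 by auto
    have "horizon n < (W + 1) * n"
      unfolding W_def using n0 dividend_less_div_times[of n "horizon n"] by simp
    hence "real (horizon n) < real ((W + 1) * n)" by (simp only: of_nat_less_iff)
    \<comment> \<open>Rounding the horizon loses at most one step, and discarding the incomplete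
      last window loses fewer than \<open>n\<close>.\<close>
    hence Wn: "n * L\<^sup>2 - 1 - n \<le> real W * n" using H by (simp add: algebra_simps)
    have "real (W * n) \<le> real (horizon n)" using WH by (simp only: of_nat_le_iff)
    hence "n * real W \<le> n * L\<^sup>2" using H by (simp add: mult.commute)
    hence W: "W \<le> L\<^sup>2" using n0 by simp
    have R: "R \<le> n * \<theta> + 1" unfolding R_def using c by linarith
    have WR: "real W * R \<le> n + L\<^sup>2"
    proof -
      have "real W * R \<le> L\<^sup>2 * (n * \<theta> + 1)" using W R by (intro mult_mono) auto
      also have "\<dots> = n + L\<^sup>2" using L0 by (simp add: \<theta>_def field_simps)
      finally show ?thesis .
    qed
    let ?e = "exp (- (real n powr (1 / 4)))"
    show ?case
    proof
      fix yes
      let ?p = "one_query_process n yes (horizon n)"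
      have "- large_gap n \<subseteq> {h. \<forall>t\<in>{1..horizon n}. Gap n h t < g}"
      proof
        fix h assume "h \<in> - large_gap n"
        hence "(MAX t\<in>{1..horizon n}. Gap n h t) < g"
          by (simp add: large_gap_def g_def L_def not_le)
        moreover have "Gap n h t \<le> (MAX t\<in>{1..horizon n}. Gap n h t)" if "t \<in> {1..horizon n}" for t
          using that by (intro Max_ge) auto
        ultimately show "h \<in> {h. \<forall>t\<in>{1..horizon n}. Gap n h t < g}" by force
      qed
      hence "measure_pmf.prob ?p (- large_gap n) \<le> measure_pmf.prob ?p {h. \<forall>t\<in>{1..horizon n}. Gap n h t < g}"
        by (intro measure_pmf.finite_measure_mono) auto
      also have "\<dots> \<le> W * exp (- (real n / (g + 1) * (real (R choose l) * (\<theta> / n) ^ l * (1 - \<theta> / n) ^ R)))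
         + exp (- (((W * n) / 8 - (4 * g + 1 + 1 / 8) * (W * R) - 4 * n * g\<^sup>2) / (8 * (4 * g + 1)\<^sup>2)))"
        using c g WH by (intro prob_small_gap_le) (auto simp: \<theta>_def l_def)
      also have "\<dots> \<le> L\<^sup>2 * ?e + ?e"
      proof (intro add_mono mult_mono)
        have "n powr (1 / 4) \<le> real n / (g + 1) * (real (R choose l) * (\<theta> / n) ^ l * (1 - \<theta> / n) ^ R)"
          using exponent_window_ge[of n L] c n0 unfolding R_def l_def g_def \<theta>_def by linarith
        thus "exp (- (real n / (g + 1) * (real (R choose l) * (\<theta> / n) ^ l * (1 - \<theta> / n) ^ R))) \<le> ?e"
          by simp
        have "n powr (1 / 4) \<le> ((n * L\<^sup>2 - 1 - n) / 8 - (4 * g + 1 + 1 / 8) * (n + L\<^sup>2) - 4 * n * g\<^sup>2)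
            / (8 * (4 * g + 1)\<^sup>2)"
          using c by simp
        also have "\<dots> \<le> ((real W * n) / 8 - (4 * g + 1 + 1 / 8) * (real W * R) - 4 * n * g\<^sup>2) / (8 * (4 * g + 1)\<^sup>2)"
          using Wn WR g by (intro divide_right_mono diff_mono mult_left_mono) auto
        finally show "exp (- (((W * n) / 8 - (4 * g + 1 + 1 / 8) * (W * R) - 4 * n * g\<^sup>2) / (8 * (4 * g + 1)\<^sup>2))) \<le> ?e"
          by simp
      qed (use W in auto)
      also have "\<dots> = (L\<^sup>2 + 1) * ?e" by (simp add: algebra_simps)
      finally have "measure_pmf.prob ?p (- large_gap n) \<le> (L\<^sup>2 + 1) * ?e" .
      moreover have "measure_pmf.prob ?p (- large_gap n) = 1 - measure_pmf.prob ?p (large_gap n)"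
        using measure_pmf.prob_compl[of "large_gap n" ?p] by (simp add: Compl_eq_Diff_UNIV)
      ultimately show "1 - ((ln n)\<^sup>2 + 1) * ?e \<le> measure_pmf.prob ?p (large_gap n)"
        by (simp add: L_def)
    qed
  qed
qed

text \<open>Both processes are instances of \<open>one_query_process\<close>, and
  \<open>prob_large_gap_ge\<close> is uniform in the answers, so one error function serves
  both.\<close>

theorem theorem4p1:
  "\<exists>\<epsilon> :: nat \<Rightarrow> real. \<epsilon> \<in> o(\<lambda>n. 1 / (real n)\<^sup>2) \<and>
     (\<forall>\<^sub>F n in sequentially.
        (\<forall>\<delta> Rank. (\<forall>h. \<delta> h \<in> {real k / real n | k. k \<in> {1..n}}) \<and> (\<forall>h. is_rank n h (Rank h)) \<longrightarrow>
           measure_pmf.prob (quantile_process n \<delta> Rank (horizon n)) (large_gap n) \<ge> 1 - \<epsilon> n) \<and>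
        (\<forall>f. measure_pmf.prob (threshold_process n f (horizon n)) (large_gap n) \<ge> 1 - \<epsilon> n))"
proof (intro exI conjI)
  show "(\<lambda>n. ((ln (real n))\<^sup>2 + 1) * exp (- (real n powr (1 / 4)))) \<in> o(\<lambda>n. 1 / (real n)\<^sup>2)"
    by real_asymp
qed (use prob_large_gap_ge in eventually_elim, simp add: quantile_process_def threshold_process_def)

end
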